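(* Let $\mathcal{J}$ be any Jordan realiser. Then $\mathcal{J}$ together with $\exists^2$ Kleene-computes functionals performing the following tasks: (1) given a set $A\subseteq[0,1]$ and $Y:[0,1]\rightarrow\mathbb{N}$ injective on $A$ (i.e. $(\forall x,y\in A)(Y(x)=Y(y)\rightarrow x=y)$), produce a sequence $(x_n)_{n\in\mathbb{N}}$ listing exactly the elements of $A$; (2) given $F:[0,1]\rightarrow[0,1]$, a set $A\subseteq[0,1]$, and $Y:[0,1]\rightarrow\mathbb{N}$ injective on $A$, produce $\sup_{x\in A}F(x)$.
   Context: Computability is Kleene's higher-order computability via S1–S9; metatheory ZFC. Sets $A\subseteq[0,1]$ are given by their characteristic functions. Kleene's $\exists^2$ is the functional $\varphi:\mathbb{N}^{\mathbb{N}}\rightarrow\{0,1\}$ with $\varphi(f)=0\leftrightarrow(\exists n)(f(n)=0)$. A function $f:[0,1]\rightarrow\mathbb{R}$ has bounded variation if there is $k_0\in\mathbb{N}$ bounding $\sum_i|f(x_i)-f(x_{i+1})|$ for every partition $0=x_0<\dots<x_n=1$. A Jordan realiser is a partial type 3 functional which, on input any $f:[0,1]\rightarrow\mathbb{R}$ of bounded variation, outputs a pair $(g,h)$ of increasing functions with $f=g-h$ on $[0,1]$.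
   Formalization: In task (1) the set A is assumed nonempty, since no sequence of reals can list exactly the elements of the empty set; in task (2) the supremum is taken in [0,1], so that it is 0 when A is empty. *)

theory Defs
  imports
    "HOL-Analysis.Analysis"
    "HOL-Library.Nat_Bijection"
    "HOL-Library.Countable"
    "HOL-Library.Lub_Glb"
begin

section \<open>Kleene's schemes S1--S9\<close>

type_synonym tp1 = "nat \<Rightarrow> nat"
type_synonym tp2 = "tp1 \<Rightarrow> nat"
type_synonym tp3 = "tp2 \<rightharpoonup> nat"

definition to_front :: "nat \<Rightarrow> 'a list \<Rightarrow> 'a list" where
  "to_front k xs = xs ! k # take k xs @ drop (Suc k) xs"

text \<open>
  \<open>kleene e ns fs Fs Ts v\<close> means \<open>{e}(ns, fs, Fs, Ts) = v\<close>, for arguments of the pure types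
  0, 1, 2 (total) and 3 (possibly partial); the value is unique if it exists.  As in
  Kleene's original presentation the relative order of arguments of different type is
  immaterial, so there is one argument list per type, and S6 moves an argument to the front of the list of its own type.  S8 applies a functional only
  to a total object of the type below, and needs that object to be in the domain if the
  functional is partial.  In S9, \<open>ma\<close>, \<open>mb\<close>, \<open>mc\<close>, \<open>md\<close> say how many arguments of
  each type are passed on.
\<close>

inductive kleene ::
    "nat \<Rightarrow> nat list \<Rightarrow> tp1 list \<Rightarrow> tp2 list \<Rightarrow> tp3 list \<Rightarrow> nat \<Rightarrow> bool" where
  S1: "kleene (list_encode [1]) (x # ns) fs Fs Ts (Suc x)"
| S2: "kleene (list_encode [2, q]) ns fs Fs Ts q"
| S3: "kleene (list_encode [3]) (x # ns) fs Fs Ts x"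
| S4: "kleene (list_encode [4, d, d']) ns fs Fs Ts v"
    if "kleene d' ns fs Fs Ts u" "kleene d (u # ns) fs Fs Ts v"
| S5_0: "kleene (list_encode [5, d, d']) (0 # ns) fs Fs Ts v"
    if "kleene d ns fs Fs Ts v"
| S5_Suc: "kleene (list_encode [5, d, d']) (Suc x # ns) fs Fs Ts v"
    if "kleene (list_encode [5, d, d']) (x # ns) fs Fs Ts u"
       "kleene d' (x # u # ns) fs Fs Ts v"
| S6_0: "kleene (list_encode [6, 0, k, d]) ns fs Fs Ts v"
    if "k < length ns" "kleene d (to_front k ns) fs Fs Ts v"
| S6_1: "kleene (list_encode [6, 1, k, d]) ns fs Fs Ts v"
    if "k < length fs" "kleene d ns (to_front k fs) Fs Ts v"
| S6_2: "kleene (list_encode [6, 2, k, d]) ns fs Fs Ts v"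
    if "k < length Fs" "kleene d ns fs (to_front k Fs) Ts v"
| S6_3: "kleene (list_encode [6, 3, k, d]) ns fs Fs Ts v"
    if "k < length Ts" "kleene d ns fs Fs (to_front k Ts) v"
| S7: "kleene (list_encode [7]) (x # ns) (f # fs) Fs Ts (f x)"
| S8_2: "kleene (list_encode [8, 2, d]) ns fs (F # Fs) Ts (F g)"
    if "\<forall>n. kleene d (n # ns) fs (F # Fs) Ts (g n)"
| S8_3: "kleene (list_encode [8, 3, d]) ns fs Fs (T # Ts) v"
    if "\<forall>\<xi>. kleene d ns (\<xi> # fs) Fs (T # Ts) (G \<xi>)" "T G = Some v"
| S9: "kleene (list_encode [9, ma, mb, mc, md]) (d # ns) fs Fs Ts v"
    if "ma \<le> length ns" "mb \<le> length fs" "mc \<le> length Fs" "md \<le> length Ts"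
       "kleene d (take ma ns) (take mb fs) (take mc Fs) (take md Ts) v"

definition E2 :: tp2 where
  "E2 f = (if \<exists>n. f n = 0 then 0 else 1)"


section \<open>Representation of reals, sets and functions\<close>

text \<open>
  Reals are given by fast converging Cauchy sequences of (codes of) rationals, and functions on
  the unit interval by type 2 functionals acting on such names.  A functional representing a
  function may behave arbitrarily on sequences that do not name an element of the unit interval.
  A real-valued function is curried: the \<open>n\<close>-th entry of a name of \<open>f(r)\<close> is the value at the
  sequence \<open>case_nat n x\<close>, that is, \<open>n\<close> followed by a name \<open>x\<close> of \<open>r\<close>.
\<close>

definition real_name :: "tp1 \<Rightarrow> real \<Rightarrow> bool" where
  "real_name x r \<longleftrightarrow>
     (\<forall>n i. \<bar>nat_to_rat_surj (x n) - nat_to_rat_surj (x (n + i))\<bar> < 1 / 2 ^ n) \<and>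
     (\<lambda>n. real_of_rat (nat_to_rat_surj (x n))) \<longlonglongrightarrow> r"

definition fun_name :: "tp2 \<Rightarrow> (real \<Rightarrow> real) \<Rightarrow> bool" where
  "fun_name \<Phi> f \<longleftrightarrow>
     (\<forall>r\<in>{0..1}. \<forall>x. real_name x r \<longrightarrow> real_name (\<lambda>n. \<Phi> (case_nat n x)) (f r))"

definition natfun_name :: "tp2 \<Rightarrow> (real \<Rightarrow> nat) \<Rightarrow> bool" where
  "natfun_name \<Phi> f \<longleftrightarrow> (\<forall>r\<in>{0..1}. \<forall>x. real_name x r \<longrightarrow> \<Phi> x = f r)"

definition set_name :: "tp2 \<Rightarrow> real set \<Rightarrow> bool" where
  "set_name \<Phi> A \<longleftrightarrow> natfun_name \<Phi> (indicator A)"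

definition computes_real ::
    "nat \<Rightarrow> nat list \<Rightarrow> tp1 list \<Rightarrow> tp2 list \<Rightarrow> tp3 list \<Rightarrow> real \<Rightarrow> bool" where
  "computes_real e ns fs Fs Ts r \<longleftrightarrow>
     (\<exists>x. (\<forall>m. kleene e (m # ns) fs Fs Ts (x m)) \<and> real_name x r)"


section \<open>Jordan realisers\<close>

definition bounded_variation :: "(real \<Rightarrow> real) \<Rightarrow> bool" where
  "bounded_variation f \<longleftrightarrow>
     (\<exists>k0::nat. \<forall>n (x :: nat \<Rightarrow> real).
        x 0 = 0 \<and> x n = 1 \<and> (\<forall>i<n. x i < x (Suc i)) \<longrightarrow>
        (\<Sum>i<n. \<bar>f (x i) - f (x (Suc i))\<bar>) \<le> real k0)"

text \<open>Coding of a pair of a type 2 and a type 1 object as one type 2 object.\<close>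

definition pair21 :: "tp2 \<Rightarrow> tp1 \<Rightarrow> tp2" where
  "pair21 \<Phi> y = (\<lambda>\<xi>. case \<xi> 0 of 0 \<Rightarrow> \<Phi> (\<lambda>n. \<xi> (Suc n)) | Suc k \<Rightarrow> y k)"

text \<open>
  A functional mapping \<open>\<Phi>\<close> to a pair \<open>(G, H)\<close> of type 2 objects is curried to a functional of
  pure type 3: the further argument \<open>case_nat i y\<close> asks for \<open>G y\<close> if \<open>i = 0\<close> and
  for \<open>H y\<close> if \<open>i = 1\<close>.
\<close>

definition jordan_realiser :: "tp3 \<Rightarrow> bool" where
  "jordan_realiser J \<longleftrightarrow>
     (\<forall>\<Phi> f. fun_name \<Phi> f \<and> bounded_variation f \<longrightarrow>
        (\<exists>G H g h.
           (\<forall>y. J (pair21 \<Phi> (case_nat 0 y)) = Some (G y)) \<and>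
           (\<forall>y. J (pair21 \<Phi> (case_nat 1 y)) = Some (H y)) \<and>
           fun_name G g \<and> fun_name H h \<and>
           mono_on {0..1} g \<and> mono_on {0..1} h \<and>
           (\<forall>r\<in>{0..1}. f r = g r - h r)))"

end

theory Submission
  imports Defs
begin

text \<open>
  The function \<open>f\<close> that is \<open>1 / 2 ^ Y r\<close> at \<open>r \<in> A\<close> and \<open>0\<close> elsewhere has bounded variation, because \<open>Y\<close> is
  injective on \<open>A\<close>.  Let \<open>f = g - h\<close> be its Jordan decomposition.  Since \<open>A\<close> is countable, every
  left neighbourhood of \<open>x \<in> A\<close> contains points outside \<open>A\<close>, where \<open>g = h\<close>; as \<open>h\<close> is increasing,
  this forces \<open>g(r) \<le> g(x) - f(x)\<close> for all \<open>r < x\<close>.  Hence any rational \<open>c\<close> with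
  \<open>g(x) - f(x) < c < g(x)\<close> determines \<open>x\<close> as the supremum of the rationals \<open>q\<close> with \<open>g(q) < c\<close>.
  Running through all \<open>c\<close>, and keeping the suprema that belong to \<open>A\<close>, enumerates \<open>A\<close>; the supremum
  of \<open>F\<close> over \<open>A\<close> is then a supremum over a sequence.

  All reals involved lie in the unit interval and have strict lower cuts that are arithmetical in
  the data, hence decidable by \<open>E2\<close>.  The \<open>m\<close>-th dyadic approximation of such a real \<open>x\<close> is
  found by counting the \<open>j < 2\<^sup>m\<close> with \<open>j / 2\<^sup>m < x\<close>, so unbounded search is never needed.
\<close>

section \<open>Closure properties of the schemes S1--S9\<close>

declare list_encode.simps [simp del]

lemma to_front_append:
  "k < length xs \<Longrightarrow> to_front k (xs @ ys) = to_front k xs @ ys"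
  by (simp add: to_front_def nth_append)

lemma kleene_append:
  "kleene e ns fs Fs Ts v \<Longrightarrow> kleene e (ns @ ms) fs Fs Ts v"
proof (induction rule: kleene.induct)
  case S1
  show ?case unfolding append_Cons by (rule kleene.S1)
next
  case S2
  show ?case by (rule kleene.S2)
next
  case S3
  show ?case unfolding append_Cons by (rule kleene.S3)
next
  case S4
  show ?case by (rule kleene.S4) (use S4.IH in simp_all)
next
  case S5_0
  show ?case unfolding append_Cons by (rule kleene.S5_0) (rule S5_0.IH)
next
  case S5_Suc
  show ?case unfolding append_Cons by (rule kleene.S5_Suc) (use S5_Suc.IH in simp_all)
next
  case S6_0
  then show ?case by (intro kleene.S6_0) (simp_all add: to_front_append)
next
  case S6_1
  then show ?case by (intro kleene.S6_1)
next
  case S6_2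
  then show ?case by (intro kleene.S6_2)
next
  case S6_3
  then show ?case by (intro kleene.S6_3)
next
  case S7
  show ?case unfolding append_Cons by (rule kleene.S7)
next
  case S8_2
  then show ?case by (intro kleene.S8_2) simp
next
  case S8_3
  then show ?case by (intro kleene.S8_3) simp_all
next
  case S9
  then show ?case unfolding append_Cons by (intro kleene.S9) simp_all
qed

lemma to_front_funpow:
  "(to_front (length us + length vs - 1) ^^ length vs) (us @ vs @ zs) = vs @ us @ zs"
proof (induction vs arbitrary: us zs rule: rev_induct)
  case (snoc v vs)
  have "to_front (length us + length vs) (us @ vs @ v # zs) = v # us @ vs @ zs"
    by (simp add: to_front_def nth_append)
  then show ?case
    using snoc.IH[of "v # us" zs] by (simp add: funpow_Suc_right del: funpow.simps)
qed simp

lemma to_front_cycle: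
  assumes "k < length xs"
  shows "(to_front k ^^ k) (to_front k xs) = xs"
proof -
  have "(to_front k ^^ Suc k) xs = xs"
    using to_front_funpow[where us = "[]" and vs = "take (Suc k) xs" and zs = "drop (Suc k) xs"] assms
    by (simp add: min_absorb2 del: funpow.simps)
  then show ?thesis by (simp add: funpow_Suc_right del: funpow.simps)
qed

definition S6_iter :: "nat \<Rightarrow> nat \<Rightarrow> nat \<Rightarrow> nat \<Rightarrow> nat" where
  "S6_iter t k j e = ((\<lambda>d. list_encode [6, t, k, d]) ^^ j) e"

lemma length_to_front [simp]: "k < length xs \<Longrightarrow> length (to_front k xs) = length xs"
  by (simp add: to_front_def)

lemma kleene_S6_iter_0:
  "kleene e ((to_front k ^^ j) ns) fs Fs Ts v \<Longrightarrow> k < length ns \<Longrightarrow>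
   kleene (S6_iter 0 k j e) ns fs Fs Ts v"
proof (induction j arbitrary: ns)
  case (Suc j)
  then have "kleene (S6_iter 0 k j e) (to_front k ns) fs Fs Ts v"
    by (simp add: funpow_Suc_right del: funpow.simps)
  then show ?case
    using Suc.prems(2) by (simp add: S6_iter_def kleene.S6_0)
qed (simp add: S6_iter_def)

lemma kleene_S6_iter_2:
  "kleene e ns fs ((to_front k ^^ j) Fs) Ts v \<Longrightarrow> k < length Fs \<Longrightarrow>
   kleene (S6_iter 2 k j e) ns fs Fs Ts v"
proof (induction j arbitrary: Fs)
  case (Suc j)
  then have "kleene (S6_iter 2 k j e) ns fs (to_front k Fs) Ts v"
    by (simp add: funpow_Suc_right del: funpow.simps)
  then show ?case
    using Suc.prems(2) by (simp add: S6_iter_def kleene.S6_2)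
qed (simp add: S6_iter_def)

locale kleene_family =
  fixes S :: "'s set"
    and fs :: "'s \<Rightarrow> tp1 list" and Fs :: "'s \<Rightarrow> tp2 list" and Ts :: "'s \<Rightarrow> tp3 list"
    and fl Fl :: nat
  assumes length_fs: "s \<in> S \<Longrightarrow> length (fs s) = fl"
    and length_Fs: "s \<in> S \<Longrightarrow> length (Fs s) = Fl"
begin

definition computable :: "nat \<Rightarrow> ('s \<Rightarrow> nat list \<Rightarrow> nat) \<Rightarrow> bool" where
  "computable a \<phi> \<longleftrightarrow>
     (\<exists>e. \<forall>s\<in>S. \<forall>ns. length ns = a \<longrightarrow> kleene e ns (fs s) (Fs s) (Ts s) (\<phi> s ns))"

lemma computableI:
  "(\<And>s ns. s \<in> S \<Longrightarrow> length ns = a \<Longrightarrow> kleene e ns (fs s) (Fs s) (Ts s) (\<phi> s ns)) \<Longrightarrow>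
   computable a \<phi>"
  unfolding computable_def by blast

lemma computableE:
  assumes "computable a \<phi>"
  obtains e where
    "\<And>s ns. s \<in> S \<Longrightarrow> length ns = a \<Longrightarrow> kleene e ns (fs s) (Fs s) (Ts s) (\<phi> s ns)"
  using assms unfolding computable_def by blast

lemma computable_const: "computable a (\<lambda>s ns. c)"
  by (rule computableI) (rule kleene.S2)

lemma computable_weaken:
  assumes "computable a \<phi>"
  obtains e where
    "\<And>s us ns. s \<in> S \<Longrightarrow> length us = j \<Longrightarrow> length ns = a \<Longrightarrow>
       kleene e (us @ ns) (fs s) (Fs s) (Ts s) (\<phi> s ns)"
proof -
  obtain e where e: "\<And>s ns. s \<in> S \<Longrightarrow> length ns = a \<Longrightarrow>
      kleene e ns (fs s) (Fs s) (Ts s) (\<phi> s ns)"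
    using assms by (rule computableE) blast
  show ?thesis
  proof (rule that)
    fix s :: 's and us ns :: "nat list"
    assume s: "s \<in> S" "length us = j" "length ns = a"
    have ap: "kleene e (ns @ us) (fs s) (Fs s) (Ts s) (\<phi> s ns)"
      using e[OF s(1) s(3)] by (rule kleene_append)
    show "kleene (if a = 0 then e else S6_iter 0 (j + a - 1) a e) (us @ ns) (fs s) (Fs s) (Ts s)
        (\<phi> s ns)"
    proof (cases "a = 0")
      case True
      then show ?thesis using ap s by simp
    next
      case False
      have "kleene (S6_iter 0 (j + a - 1) a e) (us @ ns) (fs s) (Fs s) (Ts s) (\<phi> s ns)"
        by (rule kleene_S6_iter_0) (use False s ap to_front_funpow[where us = us and vs = ns and zs = "[]"] in auto)
      then show ?thesis using False by simp
    qed
  qed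
qed

lemma computable_call:
  assumes p: "computable (length ts) p" and ts: "\<And>t. t \<in> set ts \<Longrightarrow> computable a t"
  shows "computable a (\<lambda>s ns. p s (map (\<lambda>t. t s ns) ts))"
proof -
  have main: "computable a \<psi>"
    if "\<And>t. t \<in> set us \<Longrightarrow> computable a t"
      and "\<exists>e. \<forall>s\<in>S. \<forall>ns. length ns = a \<longrightarrow>
        kleene e (map (\<lambda>t. t s ns) us @ ns) (fs s) (Fs s) (Ts s) (\<psi> s ns)" for us \<psi>
    using that
  proof (induction us)
    case Nil
    then show ?case by (simp add: computable_def)
  next
    case (Cons t us)
    obtain e where e: "\<And>s ns. s \<in> S \<Longrightarrow> length ns = a \<Longrightarrow>
        kleene e (t s ns # map (\<lambda>t. t s ns) us @ ns) (fs s) (Fs s) (Ts s) (\<psi> s ns)"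
      using Cons.prems(2) by auto
    have "computable a t" using Cons.prems(1) by simp
    then obtain d where d: "\<And>s ws ns. s \<in> S \<Longrightarrow> length ws = length us \<Longrightarrow> length ns = a \<Longrightarrow>
        kleene d (ws @ ns) (fs s) (Fs s) (Ts s) (t s ns)"
      by (rule computable_weaken[where j = "length us"]) blast
    have "kleene (list_encode [4, e, d]) (map (\<lambda>t. t s ns) us @ ns) (fs s) (Fs s) (Ts s) (\<psi> s ns)"
      if "s \<in> S" "length ns = a" for s ns
      by (rule kleene.S4[OF d e]) (use that in auto)
    then have "\<exists>e. \<forall>s\<in>S. \<forall>ns. length ns = a \<longrightarrow>
        kleene e (map (\<lambda>t. t s ns) us @ ns) (fs s) (Fs s) (Ts s) (\<psi> s ns)"
      by blast
    with Cons.prems(1) show ?case by (intro Cons.IH) simp_all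
  qed
  obtain e where "\<And>s ns. s \<in> S \<Longrightarrow> length ns = length ts \<Longrightarrow>
      kleene e ns (fs s) (Fs s) (Ts s) (p s ns)"
    using p by (rule computableE) blast
  then have "kleene e (map (\<lambda>t. t s ns) ts @ ns) (fs s) (Fs s) (Ts s)
      (p s (map (\<lambda>t. t s ns) ts))" if "s \<in> S" for s ns
    using that by (intro kleene_append) simp
  then have "\<exists>e. \<forall>s\<in>S. \<forall>ns. length ns = a \<longrightarrow>
      kleene e (map (\<lambda>t. t s ns) ts @ ns) (fs s) (Fs s) (Ts s) (p s (map (\<lambda>t. t s ns) ts))"
    by blast
  with ts show ?thesis by (rule main)
qed

lemma computable_nth:
  assumes "i < a" shows "computable a (\<lambda>s ns. ns ! i)"
proof (rule computableI)
  fix s :: 's and ns :: "nat list" assume "length ns = a"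
  then show "kleene (list_encode [6, 0, i, list_encode [3]]) ns (fs s) (Fs s) (Ts s) (ns ! i)"
    using assms by (intro kleene.S6_0) (simp, unfold to_front_def, rule kleene.S3)
qed

lemma computable_Suc:
  assumes "computable a \<phi>" shows "computable a (\<lambda>s ns. Suc (\<phi> s ns))"
proof -
  obtain e where e: "\<And>s ns. s \<in> S \<Longrightarrow> length ns = a \<Longrightarrow>
      kleene e ns (fs s) (Fs s) (Ts s) (\<phi> s ns)"
    using assms by (rule computableE) blast
  show ?thesis
    by (rule computableI, rule kleene.S4[OF e kleene.S1])
qed

lemma computable_apply:
  assumes "computable a \<phi>" "0 < fl" shows "computable a (\<lambda>s ns. (fs s ! 0) (\<phi> s ns))"
proof -
  obtain e where e: "\<And>s ns. s \<in> S \<Longrightarrow> length ns = a \<Longrightarrow>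
      kleene e ns (fs s) (Fs s) (Ts s) (\<phi> s ns)"
    using assms(1) by (rule computableE) blast
  show ?thesis
  proof (rule computableI)
    fix s and ns :: "nat list" assume s: "s \<in> S" "length ns = a"
    obtain f gs where f: "fs s = f # gs"
      using length_fs[OF s(1)] assms(2) by (cases "fs s") auto
    have "kleene (list_encode [4, list_encode [7], e]) ns (f # gs) (Fs s) (Ts s) (f (\<phi> s ns))"
      using e[OF s] unfolding f by (rule kleene.S4) (rule kleene.S7)
    then show "kleene (list_encode [4, list_encode [7], e]) ns (fs s) (Fs s) (Ts s) ((fs s ! 0) (\<phi> s ns))"
      by (simp add: f)
  qed
qed

lemma computable_rec:
  assumes "computable a b" "computable (Suc (Suc a)) st"
  shows "computable (Suc a) (\<lambda>s ns. rec_nat (b s (tl ns)) (\<lambda>i u. st s (i # u # tl ns)) (hd ns))"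
proof -
  obtain d where d: "\<And>s ns. s \<in> S \<Longrightarrow> length ns = a \<Longrightarrow>
      kleene d ns (fs s) (Fs s) (Ts s) (b s ns)"
    using assms(1) by (rule computableE) blast
  obtain d' where d': "\<And>s ns. s \<in> S \<Longrightarrow> length ns = Suc (Suc a) \<Longrightarrow>
      kleene d' ns (fs s) (Fs s) (Ts s) (st s ns)"
    using assms(2) by (rule computableE) blast
  have "kleene (list_encode [5, d, d']) (x # ns) (fs s) (Fs s) (Ts s)
      (rec_nat (b s ns) (\<lambda>i u. st s (i # u # ns)) x)" if "s \<in> S" "length ns = a" for s x and ns :: "nat list"
  proof (induction x)
    case 0
    show ?case using d[OF that] by (simp add: kleene.S5_0)
  next
    case (Suc x)
    have "kleene d' (x # rec_nat (b s ns) (\<lambda>i u. st s (i # u # ns)) x # ns) (fs s) (Fs s) (Ts s)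
        (st s (x # rec_nat (b s ns) (\<lambda>i u. st s (i # u # ns)) x # ns))"
      using d' that by simp
    with Suc show ?case unfolding old.nat.simps by (rule kleene.S5_Suc)
  qed
  then show ?thesis
    by (intro computableI[where e = "list_encode [5, d, d']"]) (auto simp: length_Suc_conv)
qed

lemma computable_apply2:
  assumes "computable (Suc a) \<phi>" "k < Fl"
  shows "computable a (\<lambda>s ns. (Fs s ! k) (\<lambda>n. \<phi> s (n # ns)))"
proof -
  obtain e where e: "\<And>s ns. s \<in> S \<Longrightarrow> length ns = Suc a \<Longrightarrow>
      kleene e ns (fs s) (Fs s) (Ts s) (\<phi> s ns)"
    using assms(1) by (rule computableE) blast
  define d where "d = S6_iter 2 k k e"
  show ?thesis
  proof (rule computableI)
    fix s and ns :: "nat list" assume s: "s \<in> S" "length ns = a"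
    have k: "k < length (Fs s)" using length_Fs[OF s(1)] assms(2) by simp
    have "kleene d (n # ns) (fs s) (to_front k (Fs s)) (Ts s) (\<phi> s (n # ns))" for n
      unfolding d_def
      by (rule kleene_S6_iter_2) (use e[OF s(1), of "n # ns"] s(2) k in \<open>auto simp: to_front_cycle\<close>)
    then have "kleene (list_encode [8, 2, d]) ns (fs s) (to_front k (Fs s)) (Ts s)
        ((Fs s ! k) (\<lambda>n. \<phi> s (n # ns)))"
      unfolding to_front_def by (intro kleene.S8_2) blast
    then show "kleene (list_encode [6, 2, k, list_encode [8, 2, d]]) ns (fs s) (Fs s) (Ts s)
        ((Fs s ! k) (\<lambda>n. \<phi> s (n # ns)))"
      using k by (intro kleene.S6_2)
  qed
qed

end

text \<open>
  Terms over a de Bruijn environment of numbers.  \<open>Q k t\<close> applies the \<open>k\<close>-th type 2 argument to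
  the function \<open>t\<close> of a newly bound number (so \<open>Q 0\<close> is a quantifier if that argument is \<open>E2\<close>),
  \<open>Rec\<close> recurses on the head of the environment, \<open>Call p ts\<close> runs \<open>p\<close> in the environment
  consisting of the values of \<open>ts\<close> only, and \<open>Ora\<close> is a binary oracle through which a type 3
  argument is accessed.  References outside the environment have the value \<open>0\<close>.
\<close>

datatype tm =
    V nat
  | C nat
  | Sc tm
  | Fn tm
  | Q nat tm
  | Rec tm tm
  | Call tm "tm list"
  | Ora

fun eval :: "(nat list \<Rightarrow> nat) \<Rightarrow> tp1 list \<Rightarrow> tp2 list \<Rightarrow> tm \<Rightarrow> nat list \<Rightarrow> nat" where
  "eval w fs Fs (V i) ns = (if i < length ns then ns ! i else 0)"
| "eval w fs Fs (C c) ns = c"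
| "eval w fs Fs (Sc t) ns = Suc (eval w fs Fs t ns)"
| "eval w fs Fs (Fn t) ns = (if fs = [] then 0 else (fs ! 0) (eval w fs Fs t ns))"
| "eval w fs Fs (Q k t) ns = (if k < length Fs then (Fs ! k) (\<lambda>n. eval w fs Fs t (n # ns)) else 0)"
| "eval w fs Fs (Rec b t) ns = (case ns of [] \<Rightarrow> 0 | x # ms \<Rightarrow>
     rec_nat (eval w fs Fs b ms) (\<lambda>i u. eval w fs Fs t (i # u # ms)) x)"
| "eval w fs Fs (Call p ts) ns = eval w fs Fs p (map (\<lambda>t. eval w fs Fs t ns) ts)"
| "eval w fs Fs Ora ns = (if length ns = 2 then w ns else 0)"

context kleene_family
begin

lemma computable_cong:
  assumes "computable a \<phi>" "\<And>s ns. s \<in> S \<Longrightarrow> length ns = a \<Longrightarrow> \<phi> s ns = \<psi> s ns"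
  shows "computable a \<psi>"
  using assms unfolding computable_def by metis

lemma computable_eval:
  assumes w: "computable 2 w"
  shows "computable a (\<lambda>s. eval (w s) (fs s) (Fs s) t)"
proof (induction t arbitrary: a)
  case (V i)
  show ?case
  proof (cases "i < a")
    case True
    then show ?thesis by (intro computable_cong[OF computable_nth[of i a]]) auto
  next
    case False
    then show ?thesis by (intro computable_cong[OF computable_const[of a 0]]) auto
  qed
next
  case (C c)
  show ?case by (rule computable_cong[OF computable_const]) auto
next
  case (Sc t)
  show ?case by (rule computable_cong[OF computable_Suc[OF Sc]]) auto
next
  case (Fn t)
  show ?case
  proof (cases "fl = 0")
    case True
    then show ?thesis
      using length_fs by (intro computable_cong[OF computable_const[of a 0]]) auto
  next
    case False
    show ?thesis
      by (rule computable_cong[OF computable_apply[OF Fn]]) (use False length_fs in auto)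
  qed
next
  case (Q k t)
  show ?case
  proof (cases "k < Fl")
    case True
    show ?thesis
      by (rule computable_cong[OF computable_apply2[OF Q True]]) (use True length_Fs in auto)
  next
    case False
    then show ?thesis
      using length_Fs by (intro computable_cong[OF computable_const[of a 0]]) auto
  qed
next
  case (Rec b t)
  show ?case
  proof (cases a)
    case 0
    then show ?thesis by (intro computable_cong[OF computable_const[of a 0]]) auto
  next
    case (Suc a')
    show ?thesis
      unfolding Suc
      by (rule computable_cong[OF computable_rec[OF Rec]]) (auto simp: length_Suc_conv)
  qed
next
  case (Call p ts)
  have "computable a (\<lambda>s ns. eval (w s) (fs s) (Fs s) p
      (map (\<lambda>t. t s ns) (map (\<lambda>t s. eval (w s) (fs s) (Fs s) t) ts)))"
    by (rule computable_call) (use Call in auto)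
  then show ?case by (rule computable_cong) (simp add: comp_def)
next
  case Ora
  show ?case
  proof (cases "a = 2")
    case True
    then show ?thesis using w by (auto intro: computable_cong)
  next
    case False
    then show ?thesis by (intro computable_cong[OF computable_const[of a 0]]) auto
  qed
qed

end

section \<open>Arithmetic programs and codes of rationals\<close>

definition code_real :: "nat \<Rightarrow> real" where
  "code_real z = real_of_rat (nat_to_rat_surj z)"

definition fcode :: "nat \<Rightarrow> nat \<Rightarrow> nat" where
  "fcode a b = prod_encode (2 * a, 2 * b)"

lemma code_real_prod_encode:
  "code_real (prod_encode (u, v)) = real_of_int (int_decode u) / real_of_int (int_decode v)"
  by (simp add: code_real_def nat_to_rat_surj_def Fract_of_int_quotient of_rat_divide)

lemma code_real_fcode [simp]: "code_real (fcode a b) = real a / real b"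
  by (simp add: fcode_def code_real_prod_encode int_decode_def sum_decode_def)

lemma code_real_0 [simp]: "code_real 0 = 0"
  using code_real_fcode[of 0 0] by (simp add: fcode_def prod_encode_def)

lemma int_decode_eq_half:
  "int_decode u = (if even u then int (Suc u div 2) else - int (Suc u div 2))"
  by (auto simp: int_decode_def sum_decode_def elim!: oddE)

lemma code_real_less_iff:
  fixes u v p m d :: nat
  defines "N \<equiv> Suc u div 2" and "D \<equiv> Suc v div 2"
  shows "code_real (prod_encode (u, v)) < (real p - real m) / real (Suc d) \<longleftrightarrow>
    (if D \<noteq> 0 then
       if u mod 2 = v mod 2 then N * Suc d + m * D < p * D else m * D < p * D + N * Suc d
     else m < p)"
proof (cases "D = 0")
  case True
  then show ?thesis
    by (simp add: code_real_prod_encode int_decode_eq_half[of v] D_def zero_less_divide_iff)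
next
  case False
  then have D: "0 < real D" by simp
  have eq: "code_real (prod_encode (u, v)) =
      (if u mod 2 = v mod 2 then real N / real D else - (real N / real D))"
  proof -
    have "int_decode u = (if even u then int N else - int N)"
      "int_decode v = (if even v then int D else - int D)"
      by (simp_all add: int_decode_eq_half N_def D_def)
    moreover have "u mod 2 = v mod 2 \<longleftrightarrow> (even u \<longleftrightarrow> even v)" by presburger
    ultimately show ?thesis by (simp add: code_real_prod_encode)
  qed
  have "real N / real D < (real p - real m) / real (Suc d) \<longleftrightarrow>
      real (N * Suc d + m * D) < real (p * D)"
    using D by (simp add: field_simps)
  moreover have "- (real N / real D) < (real p - real m) / real (Suc d) \<longleftrightarrow>
      real (m * D) < real (p * D + N * Suc d)"
    using D by (simp add: field_simps)
  ultimately show ?thesis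
    using False unfolding eq of_nat_less_iff by simp
qed

definition "tm_if c t e = Call (Rec (V 1) (V 2)) [c, t, e]"
definition "tm_not t = tm_if t (C 0) (C 1)"
definition "tm_and t u = tm_if t (tm_if u (C 1) (C 0)) (C 0)"
definition "tm_pred t = Call (Rec (C 0) (V 0)) [t]"
definition "tm_add t u = Call (Rec (V 0) (Sc (V 1))) [t, u]"
definition "tm_sub t u = Call (Rec (V 0) (tm_pred (V 1))) [u, t]"
definition "tm_mult t u = Call (Rec (C 0) (tm_add (V 1) (V 2))) [t, u]"
definition "tm_pow2 t = Call (Rec (C 1) (tm_add (V 1) (V 1))) [t]"
definition "tm_parity t = Call (Rec (C 0) (tm_not (V 1))) [t]"
definition "tm_half t = Call (Rec (C 0) (tm_add (V 1) (tm_parity (V 0)))) [t]"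
definition "tm_triangle t = Call (Rec (C 0) (tm_add (V 1) (Sc (V 0)))) [t]"
definition "tm_pair t u = tm_add (tm_triangle (tm_add t u)) t"
definition "tm_fcode t u = tm_pair (tm_add t t) (tm_add u u)"
definition "tm_less t u = tm_if (tm_sub u t) (C 1) (C 0)"
definition "tm_eq t u = tm_and (tm_not (tm_less t u)) (tm_not (tm_less u t))"
definition "tm_ex t = tm_not (Q 0 (tm_not t))"
definition "tm_all t = tm_not (tm_ex (tm_not t))"

lemma eval_if [simp]:
  "eval w fs Fs (tm_if c t e) ns =
     (if eval w fs Fs c ns \<noteq> 0 then eval w fs Fs t ns else eval w fs Fs e ns)"
  by (cases "eval w fs Fs c ns") (simp_all add: tm_if_def)

lemma eval_not [simp]: "eval w fs Fs (tm_not t) ns = of_bool (eval w fs Fs t ns = 0)"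
  by (simp add: tm_not_def)

lemma eval_and [simp]:
  "eval w fs Fs (tm_and t u) ns = of_bool (eval w fs Fs t ns \<noteq> 0 \<and> eval w fs Fs u ns \<noteq> 0)"
  by (simp add: tm_and_def)

lemma eval_pred [simp]: "eval w fs Fs (tm_pred t) ns = eval w fs Fs t ns - 1"
  by (cases "eval w fs Fs t ns") (simp_all add: tm_pred_def)

lemma eval_add [simp]: "eval w fs Fs (tm_add t u) ns = eval w fs Fs t ns + eval w fs Fs u ns"
proof -
  have "rec_nat y (\<lambda>i u. Suc u) x = x + y" for x y by (induction x) auto
  then show ?thesis by (simp add: tm_add_def)
qed

lemma eval_sub [simp]: "eval w fs Fs (tm_sub t u) ns = eval w fs Fs t ns - eval w fs Fs u ns"
proof -
  have "rec_nat y (\<lambda>i u. u - Suc 0) x = y - x" for x y by (induction x) auto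
  then show ?thesis by (simp add: tm_sub_def)
qed

lemma eval_mult [simp]: "eval w fs Fs (tm_mult t u) ns = eval w fs Fs t ns * eval w fs Fs u ns"
proof -
  have "rec_nat 0 (\<lambda>i u. u + y) x = x * y" for x y :: nat by (induction x) auto
  then show ?thesis by (simp add: tm_mult_def)
qed

lemma eval_pow2 [simp]: "eval w fs Fs (tm_pow2 t) ns = 2 ^ eval w fs Fs t ns"
proof -
  have "rec_nat (Suc 0) (\<lambda>i u. u + u) x = 2 ^ x" for x by (induction x) auto
  then show ?thesis by (simp add: tm_pow2_def)
qed

lemma eval_parity [simp]: "eval w fs Fs (tm_parity t) ns = eval w fs Fs t ns mod 2"
proof -
  have "rec_nat 0 (\<lambda>i u. of_bool (u = 0)) x = x mod 2" for x :: nat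
    by (induction x) (auto simp: mod_Suc)
  then show ?thesis by (simp add: tm_parity_def)
qed

lemma eval_half [simp]: "eval w fs Fs (tm_half t) ns = eval w fs Fs t ns div 2"
proof -
  have "rec_nat 0 (\<lambda>i u. u + i mod 2) x = x div 2" for x :: nat
    by (induction x) (auto, presburger)
  then show ?thesis by (simp add: tm_half_def)
qed

lemma eval_triangle [simp]: "eval w fs Fs (tm_triangle t) ns = triangle (eval w fs Fs t ns)"
proof -
  have "rec_nat 0 (\<lambda>i u. u + Suc i) x = triangle x" for x :: nat
    by (induction x) auto
  then show ?thesis by (simp add: tm_triangle_def)
qed

lemma eval_pair [simp]:
  "eval w fs Fs (tm_pair t u) ns = prod_encode (eval w fs Fs t ns, eval w fs Fs u ns)"
  by (simp add: tm_pair_def prod_encode_def)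

lemma eval_fcode [simp]:
  "eval w fs Fs (tm_fcode t u) ns = fcode (eval w fs Fs t ns) (eval w fs Fs u ns)"
  by (simp add: tm_fcode_def fcode_def mult_2)

lemma eval_less [simp]:
  "eval w fs Fs (tm_less t u) ns = of_bool (eval w fs Fs t ns < eval w fs Fs u ns)"
  by (simp add: tm_less_def)

lemma eval_eq [simp]:
  "eval w fs Fs (tm_eq t u) ns = of_bool (eval w fs Fs t ns = eval w fs Fs u ns)"
  by (auto simp: tm_eq_def)

lemma eval_ex [simp]:
  "eval w fs (E2 # Fs) (tm_ex t) ns = of_bool (\<exists>n. eval w fs (E2 # Fs) t (n # ns) \<noteq> 0)"
  by (simp add: tm_ex_def E2_def)

lemma eval_all [simp]:
  "eval w fs (E2 # Fs) (tm_all t) ns = of_bool (\<forall>n. eval w fs (E2 # Fs) t (n # ns) \<noteq> 0)"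
  by (simp add: tm_all_def)

definition tm_rat_less :: tm where
  "tm_rat_less = tm_ex (tm_ex (tm_and (tm_eq (V 2) (tm_pair (V 1) (V 0)))
     (tm_if (tm_half (Sc (V 0)))
       (tm_if (tm_eq (tm_parity (V 1)) (tm_parity (V 0)))
         (tm_less (tm_add (tm_mult (tm_half (Sc (V 1))) (Sc (V 5))) (tm_mult (V 4) (tm_half (Sc (V 0)))))
                  (tm_mult (V 3) (tm_half (Sc (V 0)))))
         (tm_less (tm_mult (V 4) (tm_half (Sc (V 0))))
                  (tm_add (tm_mult (V 3) (tm_half (Sc (V 0)))) (tm_mult (tm_half (Sc (V 1))) (Sc (V 5))))))
       (tm_less (V 4) (V 3)))))"

lemma eval_rat_less [simp]:
  "eval w fs (E2 # Fs) tm_rat_less [z, p, m, d] =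
     of_bool (code_real z < (real p - real m) / real (Suc d))"
proof -
  obtain u v where z: "z = prod_encode (u, v)" by (metis prod_decode_inverse surj_pair)
  have "eval w fs (E2 # Fs) tm_rat_less [z, p, m, d] = of_bool (\<exists>u v. z = prod_encode (u, v) \<and>
      code_real (prod_encode (u, v)) < (real p - real m) / real (Suc d))"
    unfolding code_real_less_iff by (simp add: tm_rat_less_def)
  then show ?thesis by (auto simp: z prod_encode_eq)
qed

definition dyadic_name :: "real \<Rightarrow> tp1" where
  "dyadic_name x m = fcode (nat \<lceil>x * 2 ^ m\<rceil>) (2 ^ m)"

definition tm_dyadic :: "tm \<Rightarrow> tm" where
  "tm_dyadic ct = tm_fcode
     (Call (Rec (C 0) (tm_add (V 1) (Call ct [V 0, tm_pow2 (V 2), V 3]))) [tm_pow2 (V 0), V 0, V 1])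
     (tm_pow2 (V 0))"

lemma eval_dyadic:
  assumes ct: "\<And>j k. eval w fs Fs ct [j, k, n] = of_bool (real j < x * real k)"
    and x: "0 \<le> x" "x \<le> 1"
  shows "eval w fs Fs (tm_dyadic ct) [m, n] = dyadic_name x m"
proof -
  have rec: "rec_nat 0 (\<lambda>i u. u + of_bool (real i < y)) k = min k (nat \<lceil>y\<rceil>)" for y k
  proof (induction k)
    case (Suc k)
    have "real k < y \<longleftrightarrow> k < nat \<lceil>y\<rceil>" by linarith
    then show ?case using Suc by auto
  qed simp
  have "x * 2 ^ m \<le> 2 ^ m" using x by (simp add: mult_left_le_one_le)
  then have "\<lceil>x * 2 ^ m\<rceil> \<le> 2 ^ m" by (simp add: ceiling_le_iff)
  then have "nat \<lceil>x * 2 ^ m\<rceil> \<le> 2 ^ m" by (simp add: nat_le_iff)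
  then show ?thesis
    by (simp add: tm_dyadic_def dyadic_name_def ct rec min_absorb2)
qed

lemma real_name_code:
  "real_name x r \<longleftrightarrow>
     (\<forall>n i. \<bar>code_real (x n) - code_real (x (n + i))\<bar> < 1 / 2 ^ n) \<and>
     (\<lambda>n. code_real (x n)) \<longlonglongrightarrow> r"
proof -
  have "\<bar>a - b\<bar> < 1 / 2 ^ n \<longleftrightarrow> \<bar>real_of_rat a - real_of_rat b\<bar> < 1 / 2 ^ n" for a b :: rat and n
  proof -
    have "1 / 2 ^ n = real_of_rat (1 / 2 ^ n)"
      by (simp add: of_rat_divide of_rat_power)
    moreover have "\<bar>real_of_rat a - real_of_rat b\<bar> = real_of_rat \<bar>a - b\<bar>"
      by (simp add: of_rat_diff[symmetric] abs_if of_rat_minus[symmetric] del: of_rat_diff of_rat_minus)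
    ultimately show ?thesis by (simp only: of_rat_less)
  qed
  then show ?thesis unfolding real_name_def code_real_def by simp
qed

lemma real_name_const: "real_name (\<lambda>_. z) (code_real z)"
  by (simp add: real_name_code)

lemma real_name_dyadic:
  assumes "0 \<le> x"
  shows "real_name (dyadic_name x) x"
proof -
  define c where "c m = code_real (dyadic_name x m)" for m
  have c: "x \<le> c m" "c m < x + 1 / 2 ^ m" for m
  proof -
    have "c m = real_of_int \<lceil>x * 2 ^ m\<rceil> / 2 ^ m"
      using assms by (simp add: c_def dyadic_name_def)
    moreover have "real_of_int \<lceil>x * 2 ^ m\<rceil> < x * 2 ^ m + 1"
      by linarith
    ultimately show "x \<le> c m" "c m < x + 1 / 2 ^ m"
      by (simp_all add: pos_le_divide_eq pos_divide_less_eq distrib_right)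
  qed
  have "\<bar>c n - c (n + i)\<bar> < 1 / 2 ^ n" for n i
  proof -
    have "1 / 2 ^ (n + i) \<le> (1 / 2 ^ n :: real)" by (simp add: field_simps)
    then show ?thesis using c[of n] c[of "n + i"] by linarith
  qed
  moreover have "c \<longlonglongrightarrow> x"
  proof (rule tendsto_sandwich[OF _ _ tendsto_const])
    show "(\<lambda>m. x + 1 / 2 ^ m) \<longlonglongrightarrow> x"
      using tendsto_add[OF tendsto_const[of x] LIMSEQ_power_zero[of "1/2::real"]]
      by (simp add: power_divide)
  qed (use c in \<open>auto intro: less_imp_le eventuallyI\<close>)
  ultimately show ?thesis by (simp add: real_name_code c_def[abs_def])
qed

section \<open>Recovering a set from a Jordan decomposition\<close>

definition spike :: "real set \<Rightarrow> (real \<Rightarrow> nat) \<Rightarrow> real \<Rightarrow> real" where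
  "spike A Y r = (if r \<in> A then 1 / 2 ^ Y r else 0)"

lemma spike_nonneg: "0 \<le> spike A Y r"
  by (simp add: spike_def)

lemma sum_spike_le:
  assumes "inj_on Y A" "finite I" "inj_on x I"
  shows "(\<Sum>i\<in>I. spike A Y (x i)) \<le> 2"
proof -
  have "(\<Sum>i\<in>I. spike A Y (x i)) = (\<Sum>r\<in>x ` I. spike A Y r)"
    using assms(3) by (simp add: sum.reindex)
  also have "\<dots> = (\<Sum>r\<in>x ` I \<inter> A. (1 / 2) ^ Y r)"
    using assms(2) by (simp add: spike_def sum.inter_restrict power_one_over)
  also have "\<dots> = (\<Sum>k\<in>Y ` (x ` I \<inter> A). (1 / 2) ^ k)"
    using assms(1) by (simp add: sum.reindex inj_on_Int)
  also have "\<dots> \<le> (\<Sum>k. (1 / 2 :: real) ^ k)"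
    using assms(2) by (intro sum_le_suminf) (auto intro: summable_geometric)
  also have "\<dots> = 2" by (simp add: suminf_geometric)
  finally show ?thesis .
qed

lemma bounded_variation_spike:
  assumes "inj_on Y A"
  shows "bounded_variation (spike A Y)"
  unfolding bounded_variation_def
proof (intro exI[of _ 4] allI impI)
  fix n and x :: "nat \<Rightarrow> real"
  assume x: "x 0 = 0 \<and> x n = 1 \<and> (\<forall>i<n. x i < x (Suc i))"
  have less: "j \<le> n \<Longrightarrow> i < j \<Longrightarrow> x i < x j" for i j
  proof (induction j)
    case (Suc j)
    have "x j < x (Suc j)" using x Suc.prems by simp
    then show ?case using Suc by (cases "i = j") auto
  qed simp
  then have "inj_on x {..n}"
    by (intro linorder_inj_onI) fastforce+
  then have inj: "inj_on x {..<n}" "inj_on (\<lambda>i. x (Suc i)) {..<n}"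
    by (force simp: inj_on_def)+
  have "(\<Sum>i<n. \<bar>spike A Y (x i) - spike A Y (x (Suc i))\<bar>)
      \<le> (\<Sum>i<n. spike A Y (x i) + spike A Y (x (Suc i)))"
    by (intro sum_mono) (simp add: abs_le_iff spike_nonneg add_increasing2)
  also have "\<dots> \<le> 2 + 2"
    unfolding sum.distrib by (intro add_mono sum_spike_le assms inj) auto
  finally show "(\<Sum>i<n. \<bar>spike A Y (x i) - spike A Y (x (Suc i))\<bar>) \<le> real 4" by simp
qed

lemma jordan_component_jump:
  assumes A: "countable A" and g: "mono_on {0..1} g" and h: "mono_on {0..1} h"
    and gh: "\<And>r. r \<in> {0..1} \<Longrightarrow> spike A Y r = g r - h r"
    and rx: "0 \<le> r" "r < x" "x \<le> 1"
  shows "g r + spike A Y x \<le> g x"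
proof -
  have "uncountable {r<..<x}" using rx(2) by (simp add: uncountable_open_interval)
  then have "\<not> {r<..<x} \<subseteq> A" using A countable_subset by blast
  then obtain t where t: "r < t" "t < x" "t \<notin> A" by (auto simp: subset_iff)
  have "g r \<le> g t" "h t \<le> h x"
    using t rx by (auto intro!: mono_onD[OF g] mono_onD[OF h])
  moreover have "g t = h t" using gh[of t] t rx by (simp add: spike_def)
  moreover have "spike A Y x = g x - h x" using gh[of x] rx by simp
  ultimately show ?thesis by linarith
qed

lemma less_Sup_insert_0_iff:
  fixes B :: "real set"
  assumes "bdd_above B"
  shows "real j < Sup (insert 0 B) * real k \<longleftrightarrow> (\<exists>q\<in>B. real j < q * real k)"
proof (cases "k = 0")
  case False
  have "real j / real k < Sup (insert 0 B) \<longleftrightarrow> (\<exists>q\<in>insert 0 B. real j / real k < q)"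
    by (rule less_cSup_iff) (use assms in auto)
  also have "\<dots> \<longleftrightarrow> (\<exists>q\<in>B. real j / real k < q)"
    using divide_nonneg_nonneg[of "real j" "real k"] by (auto simp del: divide_nonneg_nonneg)
  finally show ?thesis using False by (simp add: pos_divide_less_eq)
qed simp

lemma nat_fraction_between:
  assumes "0 \<le> u" "u < v"
  obtains a b where "u < real a / real (Suc b)" "real a / real (Suc b) < v"
proof -
  obtain q where q: "q \<in> \<rat>" "u < q" "q < v" using Rats_dense_in_real[OF assms(2)] by blast
  obtain a b :: nat where "b \<noteq> 0" "\<bar>q\<bar> = real a / real b"
    using q(1) by (rule Rats_abs_nat_div_natE)
  then have "q = real a / real (Suc (b - 1))" using q(2) assms(1) by simp
  then show ?thesis using that q by blast
qed

lemma less_fraction_iff: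
  "real j < real a / real (Suc b) * real k \<longleftrightarrow> j * Suc b < a * k"
proof -
  have "real j < real a / real (Suc b) * real k \<longleftrightarrow> real (j * Suc b) < real (a * k)"
    by (simp add: field_simps)
  then show ?thesis unfolding of_nat_less_iff .
qed

definition threshold :: "nat \<Rightarrow> real" where
  "threshold n = (case prod_decode n of (p, r) \<Rightarrow> case prod_decode r of (m, d) \<Rightarrow>
     (real p - real m) / real (Suc d))"

lemma threshold_encode [simp]:
  "threshold (prod_encode (p, prod_encode (m, d))) = (real p - real m) / real (Suc d)"
  by (simp add: threshold_def)

lemma threshold_between:
  assumes "u < v"
  obtains n where "u < threshold n" "threshold n < v"
proof -
  obtain k :: nat where k: "\<bar>u\<bar> \<le> real k" using real_arch_simple by blast
  then have "0 \<le> u + real k" "u + real k < v + real k" using assms by auto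
  then obtain a b where ab: "u + real k < real a / real (Suc b)" "real a / real (Suc b) < v + real k"
    by (rule nat_fraction_between)
  have "(real a - real (k * Suc b)) / real (Suc b) = real a / real (Suc b) - real k"
    by (simp add: field_simps)
  then show ?thesis
    using that[of "prod_encode (a, prod_encode (k * Suc b, b))"] ab by simp
qed

lemma tendsto_loose_cut:
  fixes s :: "nat \<Rightarrow> real"
  assumes "s \<longlonglongrightarrow> L"
  shows "L < c \<Longrightarrow> \<exists>N. \<forall>K. s (N + K) < c"
    and "\<exists>N. \<forall>K. s (N + K) < c \<Longrightarrow> L \<le> c"
    and "c < L \<Longrightarrow> \<exists>N. \<forall>K. c \<le> s (N + K)"
    and "\<exists>N. \<forall>K. c \<le> s (N + K) \<Longrightarrow> c \<le> L"
proof -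
  have shift: "(\<lambda>K. s (N + K)) \<longlonglongrightarrow> L" for N
    using LIMSEQ_ignore_initial_segment[OF assms, of N] by (simp add: add.commute)
  show "\<exists>N. \<forall>K. s (N + K) < c" if "L < c"
    using order_tendstoD(2)[OF assms that] le_add1 unfolding eventually_sequentially by blast
  show "\<exists>N. \<forall>K. c \<le> s (N + K)" if "c < L"
    using order_tendstoD(1)[OF assms that] le_add1 less_imp_le unfolding eventually_sequentially
    by blast
  show "L \<le> c" if ev: "\<exists>N. \<forall>K. s (N + K) < c"
  proof -
    obtain N where "\<forall>K. s (N + K) < c" using ev by blast
    then show ?thesis by (intro LIMSEQ_le_const2[OF shift[of N]]) (auto intro: less_imp_le)
  qed
  show "c \<le> L" if ev: "\<exists>N. \<forall>K. c \<le> s (N + K)"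
  proof -
    obtain N where "\<forall>K. c \<le> s (N + K)" using ev by blast
    then show ?thesis by (intro LIMSEQ_le_const[OF shift[of N]]) auto
  qed
qed

text \<open>
  If \<open>w [k, q]\<close> is the \<open>k\<close>-th entry of a name of \<open>g(q)\<close>, this set lies between
  \<open>{q. g(q) < c}\<close> and \<open>{q. g(q) \<le> c}\<close>.  That ambiguity is harmless for thresholds \<open>c\<close> inside a
  jump of \<open>g\<close>, and it avoids arithmetic with error bounds.
\<close>

definition sublevel :: "(nat list \<Rightarrow> nat) \<Rightarrow> nat \<Rightarrow> real set" where
  "sublevel w n = {real a / real (Suc b) | a b. a \<le> Suc b \<and>
     (\<exists>N. \<forall>K. code_real (w [N + K, fcode a (Suc b)]) < threshold n)}"

definition point :: "(nat list \<Rightarrow> nat) \<Rightarrow> nat \<Rightarrow> real" where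
  "point w n = Sup (insert 0 (sublevel w n))"

lemma sublevel_subset: "sublevel w n \<subseteq> {0..1}"
  by (auto simp: sublevel_def)

lemma bdd_above_sublevel: "bdd_above (sublevel w n)"
  by (rule bdd_above_mono[OF _ sublevel_subset]) simp

lemma point_bounds: "0 \<le> point w n" "point w n \<le> 1"
proof -
  show "0 \<le> point w n"
    unfolding point_def by (rule cSup_upper) (simp_all add: bdd_above_sublevel)
  show "point w n \<le> 1"
    unfolding point_def by (rule cSup_least) (use sublevel_subset[of w n] in auto)
qed

lemma point_less_iff:
  "real j < point w n * real k \<longleftrightarrow> (\<exists>a b. a \<le> Suc b \<and> j * Suc b < a * k \<and>
     (\<exists>N. \<forall>K. code_real (w [N + K, fcode a (Suc b)]) < threshold n))"
proof -
  have "(\<exists>q\<in>sublevel w n. real j < q * real k) \<longleftrightarrow>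
      (\<exists>a b. a \<le> Suc b \<and> real j < real a / real (Suc b) * real k \<and>
        (\<exists>N. \<forall>K. code_real (w [N + K, fcode a (Suc b)]) < threshold n))"
    unfolding sublevel_def by blast
  then show ?thesis
    unfolding point_def less_Sup_insert_0_iff[OF bdd_above_sublevel] less_fraction_iff .
qed

lemma point_eqI:
  assumes g: "\<And>q. code_real q \<in> {0..1} \<Longrightarrow>
      (\<lambda>k. code_real (w [k, q])) \<longlonglongrightarrow> g (code_real q)"
    and x: "0 \<le> x" "x \<le> 1"
    and below: "\<And>r. 0 \<le> r \<Longrightarrow> r < x \<Longrightarrow> g r < threshold n"
    and above: "\<And>r. x < r \<Longrightarrow> r \<le> 1 \<Longrightarrow> threshold n < g r"
  shows "point w n = x"
proof -
  have lim: "(\<lambda>k. code_real (w [k, fcode a (Suc b)])) \<longlonglongrightarrow> g (real a / real (Suc b))"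
    if "a \<le> Suc b" for a b
    using g[of "fcode a (Suc b)"] that by simp
  have "q \<le> x" if qs: "q \<in> sublevel w n" for q
  proof -
    obtain a b where q: "q = real a / real (Suc b)" "a \<le> Suc b"
      "\<exists>N. \<forall>K. code_real (w [N + K, fcode a (Suc b)]) < threshold n"
      using qs unfolding sublevel_def by blast
    have "g q \<le> threshold n" unfolding q(1) by (rule tendsto_loose_cut(2)[OF lim[OF q(2)] q(3)])
    moreover have "q \<le> 1" using q by simp
    ultimately show ?thesis using above[of q] by fastforce
  qed
  then have "point w n \<le> x" unfolding point_def by (intro cSup_least) (use x in auto)
  moreover have "x \<le> point w n"
  proof (rule ccontr)
    assume "\<not> x \<le> point w n"
    then obtain a b where ab: "point w n < real a / real (Suc b)" "real a / real (Suc b) < x"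
      using nat_fraction_between[OF point_bounds(1)[of w n], of x] by (auto simp: not_le)
    have "a \<le> Suc b" using less_le_trans[OF ab(2) x(2)] by (simp add: divide_less_eq)
    moreover have "\<exists>N. \<forall>K. code_real (w [N + K, fcode a (Suc b)]) < threshold n"
      by (rule tendsto_loose_cut(1)[OF lim[OF \<open>a \<le> Suc b\<close>] below[OF _ ab(2)]]) simp
    ultimately have "real a / real (Suc b) \<in> sublevel w n"
      unfolding sublevel_def by blast
    then have "real a / real (Suc b) \<le> point w n"
      unfolding point_def by (intro cSup_upper) (simp_all add: bdd_above_sublevel)
    then show False using ab(1) by simp
  qed
  ultimately show ?thesis by simp
qed

lemma point_surj:
  assumes A: "A \<subseteq> {0..1}" and Y: "inj_on Y A"
    and gm: "mono_on {0..1} g" and hm: "mono_on {0..1} h"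
    and gh: "\<And>r. r \<in> {0..1} \<Longrightarrow> spike A Y r = g r - h r"
    and g: "\<And>q. code_real q \<in> {0..1} \<Longrightarrow>
      (\<lambda>k. code_real (w [k, q])) \<longlonglongrightarrow> g (code_real q)"
    and x: "x \<in> A"
  shows "\<exists>n. point w n = x"
proof -
  have cA: "countable A" using Y by (rule countableI)
  have x01: "0 \<le> x" "x \<le> 1" using x A by auto
  have "g x - spike A Y x < g x" using x by (simp add: spike_def)
  then obtain n where n: "g x - spike A Y x < threshold n" "threshold n < g x"
    by (rule threshold_between)
  have "point w n = x"
  proof (rule point_eqI[OF g x01])
    fix r assume "0 \<le> r" "r < x"
    then show "g r < threshold n"
      using jordan_component_jump[OF cA gm hm gh, of r x] x01 n(1) by force
  next
    fix r assume r: "x < r" "r \<le> 1"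
    then have "g x \<le> g r" using x01 by (auto intro!: mono_onD[OF gm])
    then show "threshold n < g r" using n(2) by simp
  qed
  then show ?thesis ..
qed

section \<open>Programs using a Jordan realiser\<close>

definition spike_name :: "tp2 \<Rightarrow> tp2 \<Rightarrow> tp2" where
  "spike_name cA cY \<eta> =
     (if cA (\<lambda>n. \<eta> (Suc n)) \<noteq> 0 then fcode 1 (2 ^ cY (\<lambda>n. \<eta> (Suc n))) else 0)"

lemma set_name_eval:
  "set_name cA A \<Longrightarrow> r \<in> {0..1} \<Longrightarrow> real_name x r \<Longrightarrow> cA x = of_bool (r \<in> A)"
  by (auto simp: set_name_def natfun_name_def indicator_def)

lemma fun_name_spike:
  assumes "set_name cA A" "natfun_name cY Y"
  shows "fun_name (spike_name cA cY) (spike A Y)"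
  unfolding fun_name_def
proof (intro ballI allI impI)
  fix r x assume r: "r \<in> {0..1::real}" and x: "real_name x r"
  define z where "z = (if r \<in> A then fcode 1 (2 ^ Y r) else 0)"
  have "cY x = Y r" using assms(2) r x by (simp add: natfun_name_def)
  then have "(\<lambda>n. spike_name cA cY (case_nat n x)) = (\<lambda>_. z)"
    using set_name_eval[OF assms(1) r x] by (simp add: spike_name_def z_def)
  moreover have "code_real z = spike A Y r" by (simp add: z_def spike_def)
  ultimately show "real_name (\<lambda>n. spike_name cA cY (case_nat n x)) (spike A Y r)"
    using real_name_const[of z] by simp
qed

definition jordan_oracle :: "tp3 \<Rightarrow> tp2 \<Rightarrow> tp2 \<Rightarrow> nat list \<Rightarrow> nat" where
  "jordan_oracle J cA cY ns =
     the (J (pair21 (spike_name cA cY) (case_nat 0 (case_nat (ns ! 0) (\<lambda>_. ns ! 1)))))"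

lemma jordan_oracle_defined:
  assumes "jordan_realiser J" "inj_on Y A" "set_name cA A" "natfun_name cY Y"
  shows "J (pair21 (spike_name cA cY) (case_nat 0 (case_nat (ns ! 0) (\<lambda>_. ns ! 1)))) =
    Some (jordan_oracle J cA cY ns)"
proof -
  have "fun_name (spike_name cA cY) (spike A Y) \<and> bounded_variation (spike A Y)"
    using fun_name_spike[OF assms(3,4)] bounded_variation_spike[OF assms(2)] by simp
  then obtain G where "\<forall>y. J (pair21 (spike_name cA cY) (case_nat 0 y)) = Some (G y)"
    using assms(1) unfolding jordan_realiser_def by meson
  then show ?thesis by (simp add: jordan_oracle_def)
qed

lemma subset_range_point:
  assumes "jordan_realiser J" "inj_on Y A" "set_name cA A" "natfun_name cY Y" "A \<subseteq> {0..1}"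
  shows "A \<subseteq> range (point (jordan_oracle J cA cY))"
proof
  fix x assume x: "x \<in> A"
  have "fun_name (spike_name cA cY) (spike A Y) \<and> bounded_variation (spike A Y)"
    using fun_name_spike[OF assms(3,4)] bounded_variation_spike[OF assms(2)] by simp
  then obtain G g h where G: "\<forall>y. J (pair21 (spike_name cA cY) (case_nat 0 y)) = Some (G y)"
    and gh: "fun_name G g" "mono_on {0..1} g" "mono_on {0..1} h"
      "\<forall>r\<in>{0..1}. spike A Y r = g r - h r"
    using assms(1)[unfolded jordan_realiser_def, rule_format] by blast
  have lim: "(\<lambda>k. code_real (jordan_oracle J cA cY [k, q])) \<longlonglongrightarrow> g (code_real q)"
    if "code_real q \<in> {0..1}" for q
  proof -
    have "real_name (\<lambda>n. G (case_nat n (\<lambda>_. q))) (g (code_real q))"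
      using gh(1) that real_name_const[of q] unfolding fun_name_def by blast
    then show ?thesis unfolding real_name_code by (simp add: jordan_oracle_def G)
  qed
  have "\<exists>n. point (jordan_oracle J cA cY) n = x"
    by (rule point_surj[OF assms(5,2) gh(2,3) _ lim x]) (use gh(4) in blast)
  then show "x \<in> range (point (jordan_oracle J cA cY))" by blast
qed

definition tm_spike :: "nat \<Rightarrow> nat \<Rightarrow> tm" where
  "tm_spike iA iY =
     tm_if (Fn (C 0))
       (tm_if (tm_pred (Fn (C 0))) (tm_if (tm_pred (tm_pred (Fn (C 0)))) (V 1) (V 0)) (C 0))
       (tm_if (Q iA (Fn (Sc (Sc (V 0))))) (tm_fcode (C 1) (tm_pow2 (Q iY (Fn (Sc (Sc (V 0))))))) (C 0))"

lemma eval_tm_spike: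
  assumes "iA < length Fs" "iY < length Fs" "Fs ! iA = cA" "Fs ! iY = cY" "length ns = 2"
  shows "eval w [\<xi>] Fs (tm_spike iA iY) ns =
    pair21 (spike_name cA cY) (case_nat 0 (case_nat (ns ! 0) (\<lambda>_. ns ! 1))) \<xi>"
  using assms by (simp add: tm_spike_def pair21_def spike_name_def split: nat.split)

lemma (in kleene_family) computable_jordan_oracle:
  assumes J: "jordan_realiser J"
    and S: "\<And>s. s \<in> S \<Longrightarrow> fs s = [] \<and> Ts s = [J] \<and> Fs s ! iA = cA s \<and> Fs s ! iY = cY s \<and>
      inj_on (Y s) (A s) \<and> set_name (cA s) (A s) \<and> natfun_name (cY s) (Y s)"
    and i: "iA < Fl" "iY < Fl"
  shows "computable 2 (\<lambda>s. jordan_oracle J (cA s) (cY s))"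
proof -
  interpret inner: kleene_family "UNIV \<times> S" "\<lambda>(\<xi>, s). [\<xi>]" "\<lambda>(\<xi>, s). Fs s" "\<lambda>(\<xi>, s). Ts s" 1 Fl
    by unfold_locales (auto simp: length_Fs)
  have "inner.computable 2 (\<lambda>p. eval (\<lambda>_. 0) (case p of (\<xi>, s) \<Rightarrow> [\<xi>]) (case p of (\<xi>, s) \<Rightarrow> Fs s)
      (tm_spike iA iY))"
    by (rule inner.computable_eval[OF inner.computable_const])
  then obtain e where e: "\<forall>p\<in>UNIV \<times> S. \<forall>ns. length ns = 2 \<longrightarrow>
      kleene e ns (case p of (\<xi>, s) \<Rightarrow> [\<xi>]) (case p of (\<xi>, s) \<Rightarrow> Fs s) (case p of (\<xi>, s) \<Rightarrow> Ts s)
        (eval (\<lambda>_. 0) (case p of (\<xi>, s) \<Rightarrow> [\<xi>]) (case p of (\<xi>, s) \<Rightarrow> Fs s) (tm_spike iA iY) ns)"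
    unfolding inner.computable_def by (rule exE)
  show ?thesis
  proof (rule computableI)
    fix s and ns :: "nat list" assume s: "s \<in> S" and ns: "length ns = 2"
    have arg: "\<forall>\<xi>. kleene e ns [\<xi>] (Fs s) [J]
        (pair21 (spike_name (cA s) (cY s)) (case_nat 0 (case_nat (ns ! 0) (\<lambda>_. ns ! 1))) \<xi>)"
    proof
      fix \<xi>
      have Ts: "Ts s = [J]" using S[OF s] by blast
      have "kleene e ns [\<xi>] (Fs s) [J] (eval (\<lambda>_. 0) [\<xi>] (Fs s) (tm_spike iA iY) ns)"
        using bspec[OF e, of "(\<xi>, s)"] s ns unfolding Ts[symmetric] by simp
      moreover have "eval (\<lambda>_. 0) [\<xi>] (Fs s) (tm_spike iA iY) ns =
          pair21 (spike_name (cA s) (cY s)) (case_nat 0 (case_nat (ns ! 0) (\<lambda>_. ns ! 1))) \<xi>"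
        by (rule eval_tm_spike) (use S[OF s] i ns length_Fs[OF s] in simp_all)
      ultimately show "kleene e ns [\<xi>] (Fs s) [J]
          (pair21 (spike_name (cA s) (cY s)) (case_nat 0 (case_nat (ns ! 0) (\<lambda>_. ns ! 1))) \<xi>)"
        by simp
    qed
    have val: "J (pair21 (spike_name (cA s) (cY s)) (case_nat 0 (case_nat (ns ! 0) (\<lambda>_. ns ! 1)))) =
        Some (jordan_oracle J (cA s) (cY s) ns)"
      using S[OF s] by (intro jordan_oracle_defined[OF J]) auto
    have "kleene (list_encode [8, 3, e]) ns [] (Fs s) [J] (jordan_oracle J (cA s) (cY s) ns)"
      by (rule kleene.S8_3[OF arg, OF val])
    then show "kleene (list_encode [8, 3, e]) ns (fs s) (Fs s) (Ts s) (jordan_oracle J (cA s) (cY s) ns)"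
      using S[OF s] by simp
  qed
qed

definition tm_point_less :: tm where
  "tm_point_less = tm_ex (tm_ex (tm_ex (tm_and (tm_eq (V 5) (tm_pair (V 2) (tm_pair (V 1) (V 0))))
     (tm_ex (tm_ex (tm_and
       (tm_and (tm_not (tm_less (Sc (V 0)) (V 1))) (tm_less (tm_mult (V 5) (Sc (V 0))) (tm_mult (V 1) (V 6))))
       (tm_ex (tm_all (Call tm_rat_less
          [Call Ora [tm_add (V 1) (V 0), tm_fcode (V 3) (Sc (V 2))], V 6, V 5, V 4])))))))))"

lemma eval_point_less:
  "eval w fs (E2 # Fs) tm_point_less [j, k, n] = of_bool (real j < point w n * real k)"
proof -
  obtain p m d where n: "n = prod_encode (p, prod_encode (m, d))"
    by (metis prod_decode_inverse surj_pair)
  show ?thesis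
    unfolding point_less_iff
    by (simp add: tm_point_less_def n prod_encode_eq not_less)
qed

definition tm_point :: tm where
  "tm_point = tm_dyadic tm_point_less"

lemma eval_point [simp]: "eval w fs (E2 # Fs) tm_point [m, n] = dyadic_name (point w n) m"
  unfolding tm_point_def by (rule eval_dyadic[OF eval_point_less point_bounds])

definition tm_mem :: "nat \<Rightarrow> tm" where
  "tm_mem iA = Q iA (Call tm_point [V 0, V 1])"

lemma eval_mem:
  assumes "iA < length (E2 # Fs)" "(E2 # Fs) ! iA = cA" "set_name cA A"
  shows "eval w fs (E2 # Fs) (tm_mem iA) [n] = of_bool (point w n \<in> A)"
proof -
  have "cA (dyadic_name (point w n)) = of_bool (point w n \<in> A)"
    by (rule set_name_eval[OF assms(3) _ real_name_dyadic]) (simp_all add: point_bounds)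
  then show ?thesis using assms(1,2) by (simp add: tm_mem_def)
qed

definition enum :: "(nat list \<Rightarrow> nat) \<Rightarrow> real set \<Rightarrow> nat \<Rightarrow> real" where
  "enum w A n = point w (if point w n \<in> A then n else LEAST k. point w k \<in> A)"

lemma range_enum:
  assumes "A \<subseteq> range (point w)" "A \<noteq> {}"
  shows "range (enum w A) = A"
proof -
  have "\<exists>k. point w k \<in> A" using assms by blast
  then have "point w (LEAST k. point w k \<in> A) \<in> A" by (rule LeastI_ex)
  then have "range (enum w A) \<subseteq> A" by (auto simp: enum_def)
  moreover have "x \<in> range (enum w A)" if x: "x \<in> A" for x
  proof -
    obtain n where "x = point w n" using x assms(1) by blast
    then have "enum w A n = x" using x by (simp add: enum_def)
    then show ?thesis by blast
  qed
  ultimately show ?thesis by blast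
qed

definition tm_enum_less :: "nat \<Rightarrow> tm" where
  "tm_enum_less iA = tm_if (Call (tm_mem iA) [V 2]) (Call tm_point_less [V 0, V 1, V 2])
     (tm_ex (tm_and (tm_and (Call (tm_mem iA) [V 0])
        (tm_all (tm_not (tm_and (tm_less (V 0) (V 1)) (Call (tm_mem iA) [V 0])))))
        (Call tm_point_less [V 1, V 2, V 0])))"

lemma eval_enum_less:
  assumes "iA < length (E2 # Fs)" "(E2 # Fs) ! iA = cA" "set_name cA A"
    and "A \<subseteq> range (point w)" "A \<noteq> {}"
  shows "eval w fs (E2 # Fs) (tm_enum_less iA) [j, k, n] = of_bool (real j < enum w A n * real k)"
proof -
  have ex: "\<exists>k. point w k \<in> A" using assms(4,5) by blast
  have L: "point w m \<in> A \<and> (\<forall>i. i < m \<longrightarrow> point w i \<notin> A) \<longleftrightarrow> m = (LEAST k. point w k \<in> A)" for m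
    using LeastI_ex[OF ex] not_less_Least[of _ "\<lambda>k. point w k \<in> A"]
    by (metis (mono_tags, lifting) linorder_neqE_nat)
  have "eval w fs (E2 # Fs) (tm_enum_less iA) [j, k, n] =
      of_bool (if point w n \<in> A then real j < point w n * real k
        else \<exists>m. (point w m \<in> A \<and> (\<forall>i. i < m \<longrightarrow> point w i \<notin> A)) \<and> real j < point w m * real k)"
    by (simp add: tm_enum_less_def eval_mem[OF assms(1-3)] eval_point_less)
  then show ?thesis unfolding L by (simp add: enum_def)
qed

definition tm_apply_point :: "nat \<Rightarrow> tm" where
  "tm_apply_point iF =
     Q iF (tm_if (V 0) (Call tm_point [tm_pred (V 0), V 2]) (V 1))"

lemma eval_apply_point:
  assumes "iF < length (E2 # Fs)" "(E2 # Fs) ! iF = cF"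
  shows "eval w fs (E2 # Fs) (tm_apply_point iF) [K, n] = cF (case_nat K (dyadic_name (point w n)))"
proof -
  have "(\<lambda>v. eval w fs (E2 # Fs) (tm_if (V 0) (Call tm_point [tm_pred (V 0), V 2]) (V 1)) [v, K, n]) =
      case_nat K (dyadic_name (point w n))"
    by (rule ext) (simp split: nat.split)
  then show ?thesis using assms by (simp add: tm_apply_point_def del: eval_if)
qed

definition tm_sup_less :: "nat \<Rightarrow> nat \<Rightarrow> tm" where
  "tm_sup_less iF iA = tm_ex (tm_and (Call (tm_mem iA) [V 0])
     (tm_ex (tm_ex (tm_and (tm_less (tm_mult (V 3) (Sc (V 0))) (tm_mult (V 1) (V 4)))
       (tm_ex (tm_all (tm_not (Call tm_rat_less
         [Call (tm_apply_point iF) [tm_add (V 1) (V 0), V 4], V 3, C 0, V 2]))))))))"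

lemma eval_sup_less:
  assumes iA: "iA < length (E2 # Fs)" "(E2 # Fs) ! iA = cA" "set_name cA A"
    and iF: "iF < length (E2 # Fs)" "(E2 # Fs) ! iF = cF" "fun_name cF F"
    and A: "A \<subseteq> range (point w)" and F: "F ` {0..1} \<subseteq> {0..1}"
  shows "eval w fs (E2 # Fs) (tm_sup_less iF iA) [j, k, n] =
    of_bool (real j < Sup (insert 0 (F ` A)) * real k)"
proof -
  define s where "s n K = code_real (cF (case_nat K (dyadic_name (point w n))))" for n K
  have A01: "A \<subseteq> {0..1}" using A point_bounds[of w] by auto
  have lim: "s n \<longlonglongrightarrow> F (point w n)" for n
  proof -
    have "real_name (\<lambda>K. cF (case_nat K (dyadic_name (point w n)))) (F (point w n))"
      using iF(3) real_name_dyadic[OF point_bounds(1)] point_bounds[of w n]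
      by (simp add: fun_name_def)
    then show ?thesis by (simp add: real_name_code s_def[abs_def])
  qed
  have "eval w fs (E2 # Fs) (tm_sup_less iF iA) [j, k, n] =
      of_bool (\<exists>n. point w n \<in> A \<and> (\<exists>a b. real j < real a / real (Suc b) * real k \<and>
        (\<exists>N. \<forall>K. real a / real (Suc b) \<le> s n (N + K))))"
    unfolding less_fraction_iff
    by (simp add: tm_sup_less_def eval_mem[OF iA] eval_apply_point[OF iF(1,2)] s_def not_less)
  also have "(\<exists>n. point w n \<in> A \<and> (\<exists>a b. real j < real a / real (Suc b) * real k \<and>
        (\<exists>N. \<forall>K. real a / real (Suc b) \<le> s n (N + K)))) \<longleftrightarrow>
      (\<exists>n. point w n \<in> A \<and> real j < F (point w n) * real k)"
  proof (intro ex_cong1 conj_cong refl)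
    fix n assume n: "point w n \<in> A"
    show "(\<exists>a b. real j < real a / real (Suc b) * real k \<and>
        (\<exists>N. \<forall>K. real a / real (Suc b) \<le> s n (N + K))) \<longleftrightarrow> real j < F (point w n) * real k"
    proof
      assume "\<exists>a b. real j < real a / real (Suc b) * real k \<and>
        (\<exists>N. \<forall>K. real a / real (Suc b) \<le> s n (N + K))"
      then obtain a b where ab: "real j < real a / real (Suc b) * real k"
        "\<exists>N. \<forall>K. real a / real (Suc b) \<le> s n (N + K)" by blast
      have "real a / real (Suc b) \<le> F (point w n)" by (rule tendsto_loose_cut(4)[OF lim ab(2)])
      then have "real a / real (Suc b) * real k \<le> F (point w n) * real k"
        by (rule mult_right_mono) simp
      then show "real j < F (point w n) * real k" using ab(1) by linarith
    next
      assume j: "real j < F (point w n) * real k"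
      then have k: "0 < real k" by (cases "k = 0") auto
      then have "real j / real k < F (point w n)" using j by (simp add: pos_divide_less_eq)
      then obtain a b where ab: "real j / real k < real a / real (Suc b)"
        "real a / real (Suc b) < F (point w n)"
        using nat_fraction_between[of "real j / real k"] by auto
      then show "\<exists>a b. real j < real a / real (Suc b) * real k \<and>
          (\<exists>N. \<forall>K. real a / real (Suc b) \<le> s n (N + K))"
        using tendsto_loose_cut(3)[OF lim ab(2)] k ab(1) unfolding pos_divide_less_eq[OF k] by blast
    qed
  qed
  also have "\<dots> \<longleftrightarrow> (\<exists>q\<in>F ` A. real j < q * real k)" using A by blast
  also have "\<dots> \<longleftrightarrow> real j < Sup (insert 0 (F ` A)) * real k"
  proof (rule less_Sup_insert_0_iff[symmetric])
    have "F ` A \<subseteq> {0..1}" using F A01 by blast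
    then show "bdd_above (F ` A)" by (rule bdd_above_mono[rotated]) simp
  qed
  finally show ?thesis .
qed

lemma isLub_Sup_insert_0:
  assumes "B \<subseteq> {0..1::real}"
  shows "isLub {0..1} B (Sup (insert 0 B))"
proof -
  have bdd: "bdd_above (insert 0 B)" using assms by (intro bdd_aboveI[of _ 1]) auto
  have "0 \<le> Sup (insert 0 B)" by (rule cSup_upper[OF _ bdd]) simp
  moreover have "Sup (insert 0 B) \<le> 1" by (rule cSup_least) (use assms in auto)
  moreover have "x \<le> Sup (insert 0 B)" if "x \<in> B" for x
    by (rule cSup_upper[OF _ bdd]) (use that in simp)
  moreover have "Sup (insert 0 B) \<le> y" if "0 \<le> y" "\<And>x. x \<in> B \<Longrightarrow> x \<le> y" for y
    by (rule cSup_least) (use that in auto)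
  ultimately show ?thesis
    by (auto simp: isLub_def leastP_def isUb_def setle_def setge_def)
qed

theorem theorem3p6:
  fixes J :: tp3
  assumes "jordan_realiser J"
  shows
    "(\<exists>e. \<forall>(A :: real set) (Y :: real \<Rightarrow> nat) cA cY.
        A \<subseteq> {0..1} \<and> A \<noteq> {} \<and> inj_on Y A \<and> set_name cA A \<and> natfun_name cY Y \<longrightarrow>
        (\<exists>x :: nat \<Rightarrow> real.
           (\<forall>n. computes_real e [n] [] [E2, cA, cY] [J] (x n)) \<and> range x = A)) \<and>
     (\<exists>e. \<forall>(F :: real \<Rightarrow> real) (A :: real set) (Y :: real \<Rightarrow> nat) cF cA cY.
        F ` {0..1} \<subseteq> {0..1} \<and> A \<subseteq> {0..1} \<and> inj_on Y A \<and>
        fun_name cF F \<and> set_name cA A \<and> natfun_name cY Y \<longrightarrow>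
        (\<exists>s. computes_real e [] [] [E2, cF, cA, cY] [J] s \<and> isLub {0..1} (F ` A) s))"
proof (intro conjI)
  define S1 where "S1 = {(A, Y, cA, cY). A \<subseteq> {0..1} \<and> A \<noteq> {} \<and> inj_on Y A \<and> set_name cA A \<and>
    natfun_name cY Y}"
  interpret K1: kleene_family S1 "\<lambda>_. []" "\<lambda>(A, Y, cA, cY). [E2, cA, cY]" "\<lambda>_. [J]" 0 3
    by unfold_locales auto
  have "K1.computable 2 (\<lambda>s. jordan_oracle J (case s of (A, Y, cA, cY) \<Rightarrow> cA)
      (case s of (A, Y, cA, cY) \<Rightarrow> cY))"
    by (rule K1.computable_jordan_oracle[OF assms, where iA = 1 and iY = 2 and A = fst and Y = "fst \<circ> snd"])
      (auto simp: S1_def)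
  from K1.computable_eval[OF this, of 2 "tm_dyadic (tm_enum_less 1)"]
  obtain e where e: "\<And>A Y cA cY ns. (A, Y, cA, cY) \<in> S1 \<Longrightarrow> length ns = 2 \<Longrightarrow>
      kleene e ns [] [E2, cA, cY] [J]
        (eval (jordan_oracle J cA cY) [] [E2, cA, cY] (tm_dyadic (tm_enum_less 1)) ns)"
    by (rule K1.computableE) fastforce
  show "\<exists>e. \<forall>(A :: real set) (Y :: real \<Rightarrow> nat) cA cY.
      A \<subseteq> {0..1} \<and> A \<noteq> {} \<and> inj_on Y A \<and> set_name cA A \<and> natfun_name cY Y \<longrightarrow>
      (\<exists>x :: nat \<Rightarrow> real.
         (\<forall>n. computes_real e [n] [] [E2, cA, cY] [J] (x n)) \<and> range x = A)"
  proof (intro exI[of _ e] allI impI)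
    fix A Y cA cY
    assume A: "A \<subseteq> {0..1} \<and> A \<noteq> {} \<and> inj_on Y A \<and> set_name cA A \<and> natfun_name cY Y"
    define w where "w = jordan_oracle J cA cY"
    have sub: "A \<subseteq> range (point w)"
      unfolding w_def using A by (intro subset_range_point[OF assms]) auto
    have bounds: "0 \<le> enum w A n" "enum w A n \<le> 1" for n
      by (simp_all add: enum_def point_bounds)
    have "computes_real e [n] [] [E2, cA, cY] [J] (enum w A n)" for n
    proof -
      have "eval w [] [E2, cA, cY] (tm_dyadic (tm_enum_less 1)) [m, n] = dyadic_name (enum w A n) m" for m
        by (rule eval_dyadic[OF eval_enum_less bounds]) (use A sub in auto)
      then have "kleene e [m, n] [] [E2, cA, cY] [J] (dyadic_name (enum w A n) m)" for m
        using e[of A Y cA cY "[m, n]"] A by (simp add: S1_def w_def)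
      then show ?thesis
        unfolding computes_real_def using real_name_dyadic[OF bounds(1)] by blast
    qed
    moreover have "range (enum w A) = A" using range_enum[OF sub] A by blast
    ultimately show "\<exists>x. (\<forall>n. computes_real e [n] [] [E2, cA, cY] [J] (x n)) \<and> range x = A"
      by blast
  qed
next
  define S2 where "S2 = {(F, A, Y, cF, cA, cY). F ` {0..1::real} \<subseteq> {0..1::real} \<and> A \<subseteq> {0..1} \<and>
    inj_on Y A \<and> fun_name cF F \<and> set_name cA A \<and> natfun_name cY Y}"
  interpret K2: kleene_family S2 "\<lambda>_. []" "\<lambda>(F, A, Y, cF, cA, cY). [E2, cF, cA, cY]" "\<lambda>_. [J]" 0 4
    by unfold_locales auto
  have "K2.computable 2 (\<lambda>s. jordan_oracle J (case s of (F, A, Y, cF, cA, cY) \<Rightarrow> cA)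
      (case s of (F, A, Y, cF, cA, cY) \<Rightarrow> cY))"
    by (rule K2.computable_jordan_oracle[OF assms, where iA = 2 and iY = 3 and A = "fst \<circ> snd"
          and Y = "fst \<circ> snd \<circ> snd"])
      (auto simp: S2_def)
  from K2.computable_eval[OF this, of 1 "Call (tm_dyadic (tm_sup_less 1 2)) [V 0, C 0]"]
  obtain e where e: "\<And>F A Y cF cA cY ns. (F, A, Y, cF, cA, cY) \<in> S2 \<Longrightarrow> length ns = 1 \<Longrightarrow>
      kleene e ns [] [E2, cF, cA, cY] [J] (eval (jordan_oracle J cA cY) [] [E2, cF, cA, cY]
        (Call (tm_dyadic (tm_sup_less 1 2)) [V 0, C 0]) ns)"
    by (rule K2.computableE) fastforce
  show "\<exists>e. \<forall>(F :: real \<Rightarrow> real) (A :: real set) (Y :: real \<Rightarrow> nat) cF cA cY.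
      F ` {0..1} \<subseteq> {0..1} \<and> A \<subseteq> {0..1} \<and> inj_on Y A \<and>
      fun_name cF F \<and> set_name cA A \<and> natfun_name cY Y \<longrightarrow>
      (\<exists>s. computes_real e [] [] [E2, cF, cA, cY] [J] s \<and> isLub {0..1} (F ` A) s)"
  proof (intro exI[of _ e] allI impI)
    fix F :: "real \<Rightarrow> real" and A Y cF cA cY
    assume A: "F ` {0..1} \<subseteq> {0..1} \<and> A \<subseteq> {0..1} \<and> inj_on Y A \<and>
      fun_name cF F \<and> set_name cA A \<and> natfun_name cY Y"
    define w where "w = jordan_oracle J cA cY"
    define s where "s = Sup (insert 0 (F ` A))"
    have sub: "A \<subseteq> range (point w)"
      unfolding w_def using A by (intro subset_range_point[OF assms]) auto
    have lub: "isLub {0..1} (F ` A) s"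
      unfolding s_def using A by (intro isLub_Sup_insert_0) blast
    then have bounds: "0 \<le> s" "s \<le> 1"
      by (auto simp: isLub_def leastP_def isUb_def)
    have "eval w [] [E2, cF, cA, cY] (tm_dyadic (tm_sup_less 1 2)) [m, 0] = dyadic_name s m" for m
      unfolding s_def
      by (rule eval_dyadic[OF eval_sup_less bounds[unfolded s_def]]) (use A sub in auto)
    then have "kleene e [m] [] [E2, cF, cA, cY] [J] (dyadic_name s m)" for m
      using e[of F A Y cF cA cY "[m]"] A by (simp add: S2_def w_def)
    then have "computes_real e [] [] [E2, cF, cA, cY] [J] s"
      unfolding computes_real_def using real_name_dyadic[OF bounds(1)] by blast
    with lub show "\<exists>s. computes_real e [] [] [E2, cF, cA, cY] [J] s \<and> isLub {0..1} (F ` A) s"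
      by blast
  qed
qed

end
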